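(* Let $\mathcal R$ be a division ring and let $A,B,C$ be non-collinear points in the right vector space $\mathcal R^2$. Let $t,u,v\in\mathcal R$ with $1-t$, $1-u$, $1-v$ invertible, and let $$P=B(1-t)+Ct,\qquad Q=C(1-u)+Au,\qquad R=A(1-v)+Bv$$ be points on the lines $BC$, $CA$, $AB$ respectively. Then the points $P,Q,R$ are collinear if and only if $$u(1-u)^{-1}\,t(1-t)^{-1}\,v(1-v)^{-1}=-1 .$$
   Context: $\mathcal R^2$ is regarded as a right vector space over $\mathcal R$. Points are collinear if they lie on a common straight line, i.e. a subset of the form $\{U+Vs: s\in\mathcal R\}$ with $U,V\in\mathcal R^2$, $V\neq 0$. *)

theory Defs
  imports "HOL-Analysis.Finite_Cartesian_Product"
begin

text \<open>
  The library's scalar multiplication \<open>*s\<close> on \<open>'a ^ 'n\<close> multiplies from the left; here the scalars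
  come from a division ring and act from the right.
\<close>

definition rscale :: "'a::times ^ 'n \<Rightarrow> 'a \<Rightarrow> 'a ^ 'n"  (infixl "*\<^sub>r" 70)
  where "V *\<^sub>r s = (\<chi> i. V $ i * s)"

definition is_rline :: "('a::division_ring ^ 2) set \<Rightarrow> bool"
  where "is_rline L \<longleftrightarrow> (\<exists>U V. V \<noteq> 0 \<and> L = {U + V *\<^sub>r s | s. True})"

definition rcollinear :: "('a::division_ring ^ 2) set \<Rightarrow> bool"
  where "rcollinear S \<longleftrightarrow> (\<exists>L. is_rline L \<and> S \<subseteq> L)"

definition ring_invertible :: "'a::ring_1 \<Rightarrow> bool"
  where "ring_invertible x \<longleftrightarrow> (\<exists>y. x * y = 1 \<and> y * x = 1)"

end

theory Submission
  imports Defs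
begin

text \<open>
  Three points are collinear iff they admit a non-trivial right linear relation whose coefficients
  sum to zero. Such a relation \<open>Pa + Qb + Rc = 0\<close>, expanded in the non-collinear points
  \<open>A, B, C\<close>, splits into \<open>ub = -(1 - v)c\<close>, \<open>vc = -(1 - t)a\<close> and \<open>ta = -(1 - u)b\<close>. Going once
  around this cycle, a non-zero solution exists iff the product of the three ratios is \<open>-1\<close>.
\<close>

lemma rscale_nth [simp]: "(V *\<^sub>r s) $ i = V $ i * s"
  by (simp add: rscale_def)

lemma rscale_add_left: "(V + W) *\<^sub>r s = V *\<^sub>r s + W *\<^sub>r (s :: 'a::ring_1)"
  by (simp add: vec_eq_iff distrib_right)

lemma rscale_add_right: "V *\<^sub>r (r + s) = V *\<^sub>r r + V *\<^sub>r (s :: 'a::ring_1)"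
  by (simp add: vec_eq_iff distrib_left)

lemma rscale_rscale: "V *\<^sub>r r *\<^sub>r s = V *\<^sub>r (r * (s :: 'a::ring_1))"
  by (simp add: vec_eq_iff mult.assoc)

lemma rscale_zero [simp]: "V *\<^sub>r (0 :: 'a::ring_1) = 0" "0 *\<^sub>r (s :: 'a::ring_1) = 0"
  by (simp_all add: vec_eq_iff)

lemma rscale_one [simp]: "V *\<^sub>r (1 :: 'a::ring_1) = V"
  by (simp add: vec_eq_iff)

lemma ring_invertible_nonzero: "ring_invertible (x :: 'a::ring_1) \<Longrightarrow> x \<noteq> 0"
  by (auto simp: ring_invertible_def)

text \<open>A line needs a non-zero direction, whereas the \<open>V\<close> supplied later is a
  difference of two points and may vanish. In that case the three points coincide, and any line
  through \<open>A\<close> serves.\<close>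

lemma rcollinear_if_multiples:
  fixes A B C V :: "'a::division_ring ^ 2"
  assumes "B = A + V *\<^sub>r p" and "C = A + V *\<^sub>r q"
  shows "rcollinear {A, B, C}"
proof -
  obtain W r s where W: "W \<noteq> 0" "B = A + W *\<^sub>r r" "C = A + W *\<^sub>r s"
  proof (cases "V = 0")
    case True
    have "(1 :: 'a ^ 2) \<noteq> 0"
      by (simp add: vec_eq_iff)
    then show thesis
      using assms True that[of 1 0 0] by simp
  next
    case False
    then show thesis
      using assms that by blast
  qed
  have "A = A + W *\<^sub>r 0"
    by simp
  then have "{A, B, C} \<subseteq> {A + W *\<^sub>r s | s. True}"
    using W(2,3) by blast
  then show ?thesis
    using W(1) unfolding rcollinear_def is_rline_def by blast
qed

text \<open>On a common line the vector relation reduces to one scalar equation in the parameters,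
  which together with \<open>a + b + c = 0\<close> leaves a non-trivial solution in three unknowns.
  Conversely, eliminating \<open>a\<close> gives a relation between \<open>B - A\<close> and
  \<open>C - A\<close>, so one of them is a right multiple of the other.\<close>

lemma rcollinear_iff_relation:
  fixes A B C :: "'a::division_ring ^ 2"
  shows "rcollinear {A, B, C} \<longleftrightarrow>
    (\<exists>a b c. (a, b, c) \<noteq> (0, 0, 0) \<and> a + b + c = 0 \<and> A *\<^sub>r a + B *\<^sub>r b + C *\<^sub>r c = 0)"
    (is "?L \<longleftrightarrow> ?R")
proof
  assume ?L
  then obtain U V p q r where eq: "A = U + V *\<^sub>r p" "B = U + V *\<^sub>r q" "C = U + V *\<^sub>r r"
    unfolding rcollinear_def is_rline_def by auto
  have rel: "A *\<^sub>r a + B *\<^sub>r b + C *\<^sub>r c = U *\<^sub>r (a + b + c) + V *\<^sub>r (p * a + q * b + r * c)" for a b c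
    by (simp add: eq rscale_add_left rscale_add_right rscale_rscale)
  show ?R
  proof (cases "q = p")
    case True
    then show ?thesis
      using rel[of 1 "-1" 0] by (intro exI[of _ 1] exI[of _ "-1"] exI[of _ 0]) simp
  next
    case False
    \<comment> \<open>Normalise \<open>c = 1\<close>, so that \<open>a = - b - 1\<close>; what
      remains to solve is \<open>(q - p) * b + (r - p) = 0\<close>.\<close>
    define b where "b = - (inverse (q - p) * (r - p))"
    have "(q - p) * b = - (r - p)"
      using False by (simp add: b_def mult.assoc[symmetric])
    then have "p * (- b - 1) + q * b + r * 1 = 0"
      by (simp add: algebra_simps)
    then show ?thesis
      using rel[of "- b - 1" b 1]
      by (intro exI[of _ "- b - 1"] exI[of _ b] exI[of _ 1]) simp
  qed
next
  assume ?R
  then obtain a b c where nz: "(a, b, c) \<noteq> (0, 0, 0)" and "a + b + c = 0"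
    and rel: "A *\<^sub>r a + B *\<^sub>r b + C *\<^sub>r c = 0"
    by blast
  have a: "a = - b - c"
    using \<open>a + b + c = 0\<close> by (simp add: algebra_simps eq_neg_iff_add_eq_0)
  have rel': "(B - A) $ i * b + (C - A) $ i * c = 0" for i
    using arg_cong[OF rel, of "\<lambda>x. x $ i"] by (simp add: a algebra_simps)
  show ?L
  proof (cases "c = 0")
    case True
    \<comment> \<open>Here \<open>b\<close> is non-zero, since otherwise \<open>a\<close> would
      vanish too; hence \<open>B = A\<close>.\<close>
    then have "B = A + (C - A) *\<^sub>r 0"
      using rel' nz a by (simp add: vec_eq_iff)
    then show ?thesis
      by (rule rcollinear_if_multiples[where q = 1]) simp
  next
    case False
    have "(C - A) $ i = (B - A) $ i * - (b * inverse c)" for i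
    proof -
      have "(C - A) $ i * c = - ((B - A) $ i * b)"
        using rel'[of i] by (simp add: eq_neg_iff_add_eq_0 add.commute)
      then have "(C - A) $ i * c * inverse c = - ((B - A) $ i * b) * inverse c"
        by simp
      then show ?thesis
        using False by (simp add: mult.assoc)
    qed
    then have "C = A + (B - A) *\<^sub>r (- (b * inverse c))"
      by (simp add: vec_eq_iff algebra_simps)
    then show ?thesis
      by (rule rcollinear_if_multiples[where p = 1, rotated]) simp
  qed
qed

text \<open>One-sided inverses are two-sided, so \<open>- y\<close> is the inverse of
  \<open>x\<close>. This permits a cyclic rotation of the product although multiplication need not
  commute.\<close>

lemma mult_eq_minus_one_commute:
  fixes x y :: "'a::division_ring"
  assumes "x * y = - 1"
  shows "y * x = - 1"
proof -
  have "x * (- y) = 1"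
    using assms by simp
  then have "inverse x = - y"
    by (rule inverse_unique)
  moreover have "x \<noteq> 0"
    using assms by auto
  ultimately have "- y * x = 1"
    using left_inverse by metis
  then show ?thesis
    by (metis mult_minus_left minus_minus)
qed

text \<open>Each equation determines one unknown from the next around a cycle. Returning to
  \<open>c\<close> multiplies it on the left by a fixed scalar, which must be 1 when
  \<open>c\<close> is non-zero.\<close>

lemma cyclic_system_iff:
  fixes t u v x y z :: "'a::division_ring"
  assumes "x \<noteq> 0" "y \<noteq> 0" "z \<noteq> 0"
  shows "(\<exists>a b c. (a, b, c) \<noteq> (0, 0, 0) \<and> u * b + z * c = 0 \<and> x * a + v * c = 0 \<and> t * a + y * b = 0)
    \<longleftrightarrow> u * inverse y * t * inverse x * v * inverse z = - 1"
    (is "?L \<longleftrightarrow> ?k = - 1")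
proof
  have solve: "d = - (inverse w * e)" if "w \<noteq> 0" "w * d + e = 0" for w d e :: 'a
  proof -
    have "w * d = - e"
      using that(2) by (simp add: eq_neg_iff_add_eq_0)
    then have "inverse w * (w * d) = inverse w * - e"
      by simp
    then show ?thesis
      using that(1) by (simp add: mult.assoc[symmetric])
  qed
  assume ?L
  then obtain a b c where nz: "(a, b, c) \<noteq> (0, 0, 0)" and eqs: "z * c + u * b = 0"
    "x * a + v * c = 0" "y * b + t * a = 0"
    by (auto simp: add.commute)
  note a = solve[OF assms(1) eqs(2)] and b = solve[OF assms(2) eqs(3)]
    and c = solve[OF assms(3) eqs(1)]
  \<comment> \<open>If \<open>c\<close> were zero, \<open>a\<close> and then \<open>b\<close> would
    vanish as well.\<close>
  have "c \<noteq> 0"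
    using nz a b by auto
  have "b = inverse y * t * inverse x * v * c"
    by (subst b, subst a) (simp add: mult.assoc)
  with c have "c + inverse z * (u * (inverse y * t * inverse x * v * c)) = 0"
    by (simp add: eq_neg_iff_add_eq_0)
  then have "(1 + inverse z * (u * inverse y * t * inverse x * v)) * c = 0"
    by (simp add: distrib_right mult.assoc)
  then have "inverse z * (u * inverse y * t * inverse x * v) = - 1"
    using \<open>c \<noteq> 0\<close> by (simp add: eq_neg_iff_add_eq_0 add.commute)
  \<comment> \<open>The cycle was closed at \<open>c\<close>, which leaves \<open>inverse z\<close>
    in front; rotation moves it to the end.\<close>
  then show "?k = - 1"
    by (rule mult_eq_minus_one_commute)
next
  assume k: "?k = - 1"
  \<comment> \<open>This scaling gives \<open>z * c = 1\<close> and turns \<open>u * b\<close> into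
    exactly the product in question.\<close>
  define c where "c = inverse z"
  define a where "a = - (inverse x * v * c)"
  define b where "b = - (inverse y * t * a)"
  have "c \<noteq> 0"
    using assms(3) by (simp add: c_def)
  moreover have "u * b = ?k"
    by (simp add: a_def b_def c_def mult.assoc)
  then have "u * b + z * c = 0"
    using k assms(3) by (simp add: c_def)
  moreover have "x * a + v * c = 0"
    using assms(1) by (simp add: a_def mult.assoc[symmetric])
  moreover have "t * a + y * b = 0"
    using assms(2) by (simp add: b_def mult.assoc[symmetric])
  ultimately show ?L
    by blast
qed

theorem theorem4p12:
  fixes A B C P Q R :: "'a::division_ring ^ 2"
    and t u v :: 'a
  assumes "\<not> rcollinear {A, B, C}"
    and "ring_invertible (1 - t)" and "ring_invertible (1 - u)" and "ring_invertible (1 - v)"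
    and "P = B *\<^sub>r (1 - t) + C *\<^sub>r t"
    and "Q = C *\<^sub>r (1 - u) + A *\<^sub>r u"
    and "R = A *\<^sub>r (1 - v) + B *\<^sub>r v"
  shows "rcollinear {P, Q, R} \<longleftrightarrow>
    u * inverse (1 - u) * t * inverse (1 - t) * v * inverse (1 - v) = -1"
proof -
  have "a + b + c = 0 \<and> P *\<^sub>r a + Q *\<^sub>r b + R *\<^sub>r c = 0 \<longleftrightarrow>
      u * b + (1 - v) * c = 0 \<and> (1 - t) * a + v * c = 0 \<and> t * a + (1 - u) * b = 0" for a b c
  proof -
    \<comment> \<open>These are the coefficients of \<open>A\<close>, \<open>B\<close>,
      \<open>C\<close> after expanding the relation. Their sum is again \<open>a + b + c\<close>, so
      non-collinearity of \<open>A\<close>, \<open>B\<close>, \<open>C\<close> forces all three to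
      vanish.\<close>
    define \<alpha> \<beta> \<gamma> where "\<alpha> = u * b + (1 - v) * c" and "\<beta> = (1 - t) * a + v * c"
      and "\<gamma> = t * a + (1 - u) * b"
    have sum: "a + b + c = \<alpha> + \<beta> + \<gamma>"
      by (simp add: \<alpha>_def \<beta>_def \<gamma>_def algebra_simps)
    have "P *\<^sub>r a + Q *\<^sub>r b + R *\<^sub>r c = A *\<^sub>r \<alpha> + B *\<^sub>r \<beta> + C *\<^sub>r \<gamma>"
      unfolding assms(5-7) \<alpha>_def \<beta>_def \<gamma>_def
      by (simp only: rscale_add_left rscale_add_right rscale_rscale) (simp add: algebra_simps)
    moreover have "\<alpha> + \<beta> + \<gamma> = 0 \<and> A *\<^sub>r \<alpha> + B *\<^sub>r \<beta> + C *\<^sub>r \<gamma> = 0 \<longleftrightarrow> \<alpha> = 0 \<and> \<beta> = 0 \<and> \<gamma> = 0"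
      using assms(1) unfolding rcollinear_iff_relation by auto
    ultimately show ?thesis
      unfolding sum by (simp add: \<alpha>_def \<beta>_def \<gamma>_def)
  qed
  then show ?thesis
    unfolding rcollinear_iff_relation
    using cyclic_system_iff[OF assms(2-4)[THEN ring_invertible_nonzero], of u v t] by simp
qed

end
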